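(* Let $\mathbb{K}\in\{\mathbb{R},\mathbb{C}\}$, let $L$ be a compact Hausdorff space, and let $\mathcal{A}\subseteq\mathcal{C}(L,\mathbb{K})$ be a self-adjoint algebra over $\mathbb{K}$ that vanishes nowhere on $L$. If $\sim_{\mathcal{A}}$ is infinite and $\{[x]\in L/\sim_{\mathcal{A}}:|[x]|>1\}$ is finite, then $\mathcal{C}(L,\mathbb{K})\setminus\overline{\mathcal{A}}$ is $sw(L')$-lineable but not $sw(L')^{+}$-lineable, where $L':=\{x\in L:|[x]|>1\}$.
   Context: For a compact Hausdorff space $X$, $\mathcal{C}(X,\mathbb{K})$ is the Banach space of continuous functions $X\to\mathbb{K}$ with the sup-norm, and its Stone-Weierstrass character is $sw(X):=\dim(\mathcal{C}(X,\mathbb{K}))$ (algebraic dimension over $\mathbb{K}$; the value is the same for $\mathbb{K}=\mathbb{R}$ and $\mathbb{K}=\mathbb{C}$). $\overline{\mathcal{A}}$ is the norm closure. An algebra is a linear subspace closed under products (not necessarily containing constants). $\mathcal{A}$ is self-adjoint if $f\in\mathcal{A}$ implies $\overline{f}\in\mathcal{A}$; it vanishes nowhere on $L$ if for every $x\in L$ there is $f\in\mathcal{A}$ with $f(x)\neq 0$. The relation $\sim_{\mathcal{A}}$ on $L$ is defined by $x\sim_{\mathcal{A}}y$ iff $f(x)=f(y)$ for all $f\in\mathcal{A}$, and $[x]$ is the class of $x$. (Under the hypotheses $L'$ is a finite union of closed classes, hence closed in $L$.) An equivalence relation on $L$ is infinite if its order $|L\setminus R|$ is infinite, where $R\subseteq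 L$ is a set containing exactly one element of each class (the cardinal $|L\setminus R|$ does not depend on $R$). $\kappa^{+}$ is the least cardinal greater than $\kappa$. A subset $M$ of a vector space $V$ is $\kappa$-lineable if $M\cup\{0\}$ contains a vector subspace of $V$ of (algebraic) dimension $\kappa$ over $\mathbb{K}$. *)

theory Defs
  imports "HOL-Analysis.Analysis" "HOL-Library.Function_Algebras"
begin

unbundle cardinal_syntax

text \<open>
  The scalar field is the type \<open>'k\<close>, used at \<open>real\<close> and \<open>complex\<close>. Functions on a space \<open>X\<close> are
  represented by total functions that vanish outside \<open>topspace X\<close>, so that they are determined
  by their values on \<open>topspace X\<close> and form a subspace of \<open>'a \<Rightarrow> 'k\<close> with pointwise operations.
\<close>

definition fscale :: "'k::field \<Rightarrow> ('a \<Rightarrow> 'k) \<Rightarrow> 'a \<Rightarrow> 'k"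
  where "fscale c f = (\<lambda>x. c * f x)"

global_interpretation fun_space: vector_space fscale
  by unfold_locales (auto simp: fscale_def fun_eq_iff algebra_simps)

definition cont_funs :: "'a topology \<Rightarrow> ('a \<Rightarrow> 'k::real_normed_field) set"
  where "cont_funs X = {f. continuous_map X euclidean f \<and> (\<forall>x. x \<notin> topspace X \<longrightarrow> f x = 0)}"

text \<open>Inserting \<open>0\<close> only matters for the empty space.\<close>

definition sup_norm :: "'a topology \<Rightarrow> ('a \<Rightarrow> 'k::real_normed_field) \<Rightarrow> real"
  where "sup_norm X f = Sup (insert 0 ((\<lambda>x. norm (f x)) ` topspace X))"

definition norm_closure ::
    "'a topology \<Rightarrow> ('a \<Rightarrow> 'k::real_normed_field) set \<Rightarrow> ('a \<Rightarrow> 'k) set"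
  where "norm_closure X A = {f \<in> cont_funs X. \<forall>e>0. \<exists>g\<in>A. sup_norm X (f - g) < e}"

definition hamel_basis :: "('a \<Rightarrow> 'k::field) set \<Rightarrow> ('a \<Rightarrow> 'k) set \<Rightarrow> bool"
  where "hamel_basis B V \<longleftrightarrow> fun_space.independent B \<and> fun_space.span B = V"

text \<open>
  The algebraic dimension as a cardinal, finite or infinite (unlike the library's \<open>dim\<close>, which
  is a natural number). It is meaningful for subspaces \<open>V\<close>; any two bases are equipotent.
\<close>

definition hamel_dim :: "('a \<Rightarrow> 'k::field) set \<Rightarrow> ('a \<Rightarrow> 'k) rel"
  where "hamel_dim V = |SOME B. hamel_basis B V|"

definition sw :: "'a topology \<Rightarrow> ('a \<Rightarrow> 'k::real_normed_field) rel"
  where "sw X = hamel_dim (cont_funs X)"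

definition lineable :: "'c rel \<Rightarrow> ('a \<Rightarrow> 'k::field) set \<Rightarrow> bool"
  where "lineable \<kappa> M \<longleftrightarrow>
    (\<exists>W. fun_space.subspace W \<and> W \<subseteq> M \<union> {0} \<and> hamel_dim W =o \<kappa>)"

definition function_algebra :: "'a topology \<Rightarrow> ('a \<Rightarrow> 'k::real_normed_field) set \<Rightarrow> bool"
  where "function_algebra X A \<longleftrightarrow>
    A \<subseteq> cont_funs X \<and> fun_space.subspace A \<and> (\<forall>f\<in>A. \<forall>g\<in>A. f * g \<in> A)"

text \<open>The first argument is the conjugation of the scalar field: \<open>cnj\<close> on \<open>complex\<close>, \<open>id\<close> on \<open>real\<close>.\<close>

definition self_adjoint :: "('k \<Rightarrow> 'k) \<Rightarrow> ('a \<Rightarrow> 'k) set \<Rightarrow> bool"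
  where "self_adjoint \<sigma> A \<longleftrightarrow> (\<forall>f\<in>A. (\<lambda>x. \<sigma> (f x)) \<in> A)"

definition vanishes_nowhere :: "'a topology \<Rightarrow> ('a \<Rightarrow> 'k::zero) set \<Rightarrow> bool"
  where "vanishes_nowhere X A \<longleftrightarrow> (\<forall>x\<in>topspace X. \<exists>f\<in>A. f x \<noteq> 0)"

definition sim :: "'a topology \<Rightarrow> ('a \<Rightarrow> 'k) set \<Rightarrow> 'a rel"
  where "sim X A = {(x, y). x \<in> topspace X \<and> y \<in> topspace X \<and> (\<forall>f\<in>A. f x = f y)}"

definition transversal :: "'a set \<Rightarrow> 'a rel \<Rightarrow> 'a set \<Rightarrow> bool"
  where "transversal S r T \<longleftrightarrow> T \<subseteq> S \<and> (\<forall>c\<in>S // r. \<exists>!x. x \<in> c \<inter> T)"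

text \<open>The cardinal \<open>|S - T|\<close> is the same for all transversals \<open>T\<close>.\<close>

definition infinite_equiv :: "'a set \<Rightarrow> 'a rel \<Rightarrow> bool"
  where "infinite_equiv S r \<longleftrightarrow> (\<exists>T. transversal S r T \<and> infinite (S - T))"

text \<open>More than one element; \<open>card c > 1\<close> would exclude infinite sets.\<close>

definition nontrivial :: "'a set \<Rightarrow> bool"
  where "nontrivial c \<longleftrightarrow> (\<exists>x\<in>c. \<exists>y\<in>c. x \<noteq> y)"

definition nontrivial_points :: "'a topology \<Rightarrow> ('a \<Rightarrow> 'k) set \<Rightarrow> 'a set"
  where "nontrivial_points X A = {x \<in> topspace X. nontrivial (sim X A `` {x})}"

end

theory Submission
  imports Defs
begin

text \<open>
  Let \<open>N\<close> be the set of points whose class under \<open>sim L A\<close> is nontrivial, and let \<open>B\<close> be the space of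
  continuous functions that are constant on the classes. The proof computes the codimension of
  the closure of \<open>A\<close> in the space of continuous functions \<open>V\<close>, and reads off lineability from it.
  
  By the Stone-Weierstrass theorem the closure of \<open>A\<close> is exactly \<open>B\<close>
  (\<open>norm_closure_real_algebra\<close>, \<open>norm_closure_complex_algebra\<close>). Membership in \<open>B\<close> only depends on
  the restriction to \<open>N\<close>: outside \<open>N\<close> the classes are singletons and impose no condition. Hence the
  restriction map \<open>r\<close> from \<open>V\<close> to functions on \<open>N\<close> satisfies \<open>f \<in> B \<longleftrightarrow> r f \<in> r ` B\<close>. As a finite union of
  closed classes, \<open>N\<close> is closed, so by Tietze's theorem \<open>r\<close> maps \<open>V\<close> onto the space \<open>U\<close> of all
  continuous functions on \<open>N\<close>, whose dimension is \<open>\<kappa> = sw N\<close>.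
  
  \<^item> \<^emph>\<open>A subspace of dimension \<open>\<kappa>\<close>.\<close> The space \<open>D = r ` B\<close> has finite dimension, because a function
    in it is determined by one value on each of the finitely many nontrivial classes. In
    contrast \<open>U\<close> has infinite dimension, because \<open>N\<close> is infinite and finitely many points can be
    separated by continuous functions. A basis of \<open>D\<close> extended to one of \<open>U\<close> thus gains \<open>\<kappa>\<close> new
    vectors, and preimages of these under \<open>r\<close> span a subspace of \<open>V\<close> that meets \<open>B\<close> only in \<open>0\<close>
    (\<open>large_subspace_avoiding_preimage\<close>).
  
  \<^item> \<^emph>\<open>No subspace of larger dimension.\<close> The kernel of \<open>r\<close> on \<open>V\<close> is contained in \<open>B\<close>. A subspace
    of \<open>V\<close> that meets \<open>B\<close> only in \<open>0\<close> is therefore mapped injectively into \<open>U\<close>, so its dimension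
    is at most \<open>\<kappa>\<close>.
\<close>

section \<open>Hamel bases and infinite dimensions\<close>

text \<open>
  The choice in the definition of the dimension is harmless, because any two bases of a space
  are equipotent, also when they are infinite.
\<close>

lemma hamel_dim_ordIso_basis:
  assumes "hamel_basis B V"
  shows "hamel_dim V =o |B|"
proof -
  have "hamel_basis (SOME B. hamel_basis B V) V"
    using assms by (rule someI)
  then have "\<exists>f. bij_betw f (SOME B. hamel_basis B V) B"
    using assms by (intro fun_space.bij_if_span_eq_span_bases) (auto simp: hamel_basis_def)
  then show ?thesis
    unfolding hamel_dim_def by (simp add: card_of_ordIso)
qed

lemma hamel_basis_extend:
  assumes "fun_space.subspace V" "S \<subseteq> V" "fun_space.independent S"
  obtains B where "S \<subseteq> B" "B \<subseteq> V" "hamel_basis B V"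
proof -
  obtain B where B: "S \<subseteq> B" "B \<subseteq> V" "fun_space.independent B" "V \<subseteq> fun_space.span B"
    using fun_space.maximal_independent_subset_extend[OF assms(2,3)] by blast
  have "fun_space.span B \<subseteq> V"
    using B(2) assms(1) by (rule fun_space.span_minimal)
  with B that show thesis
    unfolding hamel_basis_def by blast
qed

lemma hamel_basis_exists:
  assumes "fun_space.subspace V"
  obtains B where "B \<subseteq> V" "hamel_basis B V"
proof (rule hamel_basis_extend[OF assms])
  show "fun_space.independent {}"
    by (rule fun_space.independent_empty)
qed (use that in auto)

lemma Card_order_hamel_dim: "Card_order (hamel_dim V)"
  unfolding hamel_dim_def by (rule card_of_Card_order)

lemma hamel_dim_inj_image:
  fixes r :: "('a \<Rightarrow> 'k::field) \<Rightarrow> 'b \<Rightarrow> 'k"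
  assumes r: "Vector_Spaces.linear fscale fscale r"
    and W: "fun_space.subspace W" and inj: "inj_on r W"
  shows "hamel_dim (r ` W) =o hamel_dim W"
proof -
  interpret r: Vector_Spaces.linear fscale fscale r by (rule r)
  obtain B where B: "B \<subseteq> W" "hamel_basis B W"
    by (rule hamel_basis_exists[OF W])
  then have "hamel_basis (r ` B) (r ` W)"
    using inj r.independent_injective_image[of B] r.span_image[of B] 
    by (auto simp: hamel_basis_def)
  then have "hamel_dim (r ` W) =o |r ` B|"
    by (rule hamel_dim_ordIso_basis)
  also have "|r ` B| =o |B|"
    using inj_on_imp_bij_betw[OF inj_on_subset[OF inj B(1)]]
    by (rule ordIso_symmetric[OF card_of_ordIsoI])
  also have "|B| =o hamel_dim W"
    using B(2) by (rule ordIso_symmetric[OF hamel_dim_ordIso_basis])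
  finally show ?thesis .
qed

lemma hamel_dim_mono:
  assumes "fun_space.subspace W" "fun_space.subspace U" "W \<subseteq> U"
  shows "hamel_dim W \<le>o hamel_dim U"
proof -
  obtain B where B: "B \<subseteq> W" "hamel_basis B W"
    by (rule hamel_basis_exists[OF assms(1)])
  have "B \<subseteq> U" "fun_space.independent B"
    using B assms(3) by (auto simp: hamel_basis_def)
  then obtain C where C: "B \<subseteq> C" "hamel_basis C U"
    by (rule hamel_basis_extend[OF assms(2)])
  have "hamel_dim W =o |B|"
    using B(2) by (rule hamel_dim_ordIso_basis)
  also have "|B| \<le>o |C|"
    using C(1) by (rule card_of_mono1)
  also have "|C| =o hamel_dim U"
    using C(2) by (rule ordIso_symmetric[OF hamel_dim_ordIso_basis])
  finally show ?thesis .
qed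

text \<open>
  Removing finitely many vectors from an infinite basis does not change its cardinality, so an
  algebraic complement of \<open>D\<close> in \<open>U\<close>, spanned by \<open>F\<close>, still has the dimension of \<open>U\<close>.
\<close>

lemma complement_of_finite_dim_subspace:
  assumes U: "fun_space.subspace U" and D: "fun_space.subspace D" "D \<subseteq> U"
    and T: "finite T" "D \<subseteq> fun_space.span T"
    and inf: "\<And>T'. finite T' \<Longrightarrow> \<not> U \<subseteq> fun_space.span T'"
  obtains E F where "fun_space.independent (E \<union> F)" "E \<inter> F = {}"
    "fun_space.span E = D" "F \<subseteq> U" "hamel_dim U =o |F|"
proof -
  obtain E where E: "E \<subseteq> D" "hamel_basis E D"
    by (rule hamel_basis_exists[OF D(1)])
  have finE: "finite E"
    using fun_space.independent_span_bound[OF T(1), of E] E T(2) by (auto simp: hamel_basis_def)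
  have "E \<subseteq> U" "fun_space.independent E"
    using E D(2) by (auto simp: hamel_basis_def)
  then obtain G where G: "E \<subseteq> G" "G \<subseteq> U" "hamel_basis G U"
    by (rule hamel_basis_extend[OF U])
  define F where "F = G - E"
  have GEF: "G = E \<union> F"
    using G(1) by (auto simp: F_def)
  have "infinite G"
    using inf[of G] G(3) by (auto simp: hamel_basis_def)
  then have infF: "infinite F"
    using finE by (simp add: F_def)
  have "|E| \<le>o |F|"
    using ordLeq_total[OF card_of_Well_order card_of_Well_order, of E F]
      card_of_ordLeq_finite[of F E] finE infF by blast
  then have "|G| \<le>o |F|"
    unfolding GEF using infF card_of_Card_order card_of_mono1[OF order_refl]
    by (intro card_of_Un_ordLeq_infinite_Field) (simp_all only: Field_card_of not_False_eq_True)
  moreover have "|F| \<le>o |G|"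
    unfolding F_def by (rule card_of_mono1[OF Diff_subset])
  ultimately have "|G| =o |F|"
    unfolding ordIso_iff_ordLeq by (rule conjI)
  with hamel_dim_ordIso_basis[OF G(3)] have "hamel_dim U =o |F|"
    by (rule ordIso_transitive)
  moreover have "fun_space.independent (E \<union> F)" "fun_space.span E = D"
    using E(2) G(3) unfolding GEF hamel_basis_def by auto
  moreover have "E \<inter> F = {}" "F \<subseteq> U"
    using G(2) by (auto simp: F_def)
  ultimately show thesis
    by (intro that[of E F])
qed

text \<open>
  The quotient of \<open>V\<close> by \<open>{v \<in> V. r v \<in> D}\<close> is isomorphic to that of \<open>r ` V\<close> by \<open>D\<close>. The latter has the
  dimension of \<open>r ` V\<close>, since only finitely many dimensions are lost, and \<open>W\<close> is a lift of it to \<open>V\<close>.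
\<close>

lemma large_subspace_avoiding_preimage:
  fixes r :: "('a \<Rightarrow> 'k::field) \<Rightarrow> 'b \<Rightarrow> 'k"
  assumes r: "Vector_Spaces.linear fscale fscale r"
    and V: "fun_space.subspace V"
    and D: "fun_space.subspace D" "D \<subseteq> r ` V"
    and T: "finite T" "D \<subseteq> fun_space.span T"
    and inf: "\<And>T'. finite T' \<Longrightarrow> \<not> r ` V \<subseteq> fun_space.span T'"
  obtains W where "fun_space.subspace W" "W \<subseteq> V" "\<forall>w\<in>W. r w \<in> D \<longrightarrow> w = 0"
    "hamel_dim W =o hamel_dim (r ` V)"
proof -
  interpret r: Vector_Spaces.linear fscale fscale r by (rule r)
  interpret rev: vector_space_pair "fscale :: 'k \<Rightarrow> ('b \<Rightarrow> 'k) \<Rightarrow> _" "fscale :: 'k \<Rightarrow> ('a \<Rightarrow> 'k) \<Rightarrow> _" ..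
  have U: "fun_space.subspace (r ` V)"
    using V by (rule r.subspace_image)
  obtain E F where EF: "fun_space.independent (E \<union> F)" "E \<inter> F = {}"
    "fun_space.span E = D" "F \<subseteq> r ` V" "hamel_dim (r ` V) =o |F|"
    by (rule complement_of_finite_dim_subspace[OF U D T inf])
  have "\<forall>f\<in>F. \<exists>v. v \<in> V \<and> r v = f"
    using EF(4) by auto
  from bchoice[OF this] obtain q where q: "\<And>f. f \<in> F \<Longrightarrow> q f \<in> V \<and> r (q f) = f"
    by auto
  \<comment> \<open>A linear section of r over the span of F that kills D: on the intended
    intersection of W with the preimage of D it is both injective and zero.\<close>
  obtain s where "Vector_Spaces.linear fscale fscale s"
    and "\<forall>f\<in>E \<union> F. s f = (if f \<in> F then q f else 0)"
    using rev.linear_independent_extend[OF EF(1), of "\<lambda>f. if f \<in> F then q f else 0"] by auto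
  then interpret s: Vector_Spaces.linear fscale fscale s by simp
  have s: "f \<in> F \<Longrightarrow> s f = q f" "f \<in> E \<Longrightarrow> s f = 0" for f
    using \<open>\<forall>f\<in>E \<union> F. _\<close> EF(2) by auto
  have s_D: "s u = 0" if "u \<in> D" for u
    using that EF(3) s(2) s.eq_0_on_span[of E u] by blast
  have rs: "r (s u) = u" if "u \<in> fun_space.span F" for u
  proof -
    have "fun_space.subspace {u. r (s u) = u}"
      by (rule fun_space.subspaceI)
        (simp_all only: mem_Collect_eq r.zero s.zero r.add s.add r.scale s.scale)
    then have "fun_space.span F \<subseteq> {u. r (s u) = u}"
      using s q by (intro fun_space.span_minimal) auto
    with that show ?thesis
      by auto
  qed
  have inj: "inj_on s (fun_space.span F)"
    by (rule inj_on_inverseI[of _ r]) (rule rs)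
  have indF: "fun_space.independent F"
    using EF(1) by (rule fun_space.independent_mono) simp
  define W where "W = s ` fun_space.span F"
  show thesis
  proof
    show "fun_space.subspace W"
      unfolding W_def by (intro s.subspace_image fun_space.subspace_span)
    show "W \<subseteq> V"
      unfolding W_def s.span_image[symmetric] using V s q
      by (intro fun_space.span_minimal) auto
    show "\<forall>w\<in>W. r w \<in> D \<longrightarrow> w = 0"
      using rs s_D by (auto simp: W_def)
    have "hamel_dim W =o hamel_dim (fun_space.span F)"
      unfolding W_def
      by (intro hamel_dim_inj_image s.linear_axioms fun_space.subspace_span inj)
    also have "hamel_dim (fun_space.span F) =o |F|"
      using indF by (intro hamel_dim_ordIso_basis) (simp add: hamel_basis_def)
    also have "|F| =o hamel_dim (r ` V)"
      using EF(5) by (rule ordIso_symmetric)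
    finally show "hamel_dim W =o hamel_dim (r ` V)" .
  qed
qed

text \<open>
  Functions that restrict to the unit vectors on a set of \<open>n\<close> points are linearly independent,
  and \<open>n\<close> can be chosen larger than the size of any finite spanning set.
\<close>

lemma not_finite_dim_if_separating:
  fixes U :: "('a \<Rightarrow> 'k::field) set"
  assumes "infinite N"
    and sep: "\<And>P p. finite P \<Longrightarrow> P \<subseteq> N \<Longrightarrow> p \<in> P \<Longrightarrow> \<exists>e\<in>U. e p = 1 \<and> (\<forall>q\<in>P - {p}. e q = 0)"
    and "finite T"
  shows "\<not> U \<subseteq> fun_space.span T"
proof
  assume UT: "U \<subseteq> fun_space.span T"
  obtain P where P: "finite P" "card P = Suc (card T)" "P \<subseteq> N"
    using infinite_arbitrarily_large[OF assms(1)] by blast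
  have "\<forall>p\<in>P. \<exists>e. e \<in> U \<and> e p = 1 \<and> (\<forall>q\<in>P - {p}. e q = 0)"
    using sep[OF P(1,3)] by blast
  from bchoice[OF this] obtain e
    where e0: "\<forall>p\<in>P. e p \<in> U \<and> e p p = 1 \<and> (\<forall>q\<in>P - {p}. e p q = 0)"
    by blast
  then have e: "\<And>p. p \<in> P \<Longrightarrow> e p \<in> U" "\<And>p. p \<in> P \<Longrightarrow> e p p = 1"
    "\<And>p q. p \<in> P \<Longrightarrow> q \<in> P \<Longrightarrow> q \<noteq> p \<Longrightarrow> e p q = 0"
    by auto
  have inj: "inj_on e P"
    by (rule inj_onI) (metis e(2,3) zero_neq_one)
  have "fun_space.independent (e ` P)"
    unfolding fun_space.dependent_def
  proof safe
    fix p assume p: "p \<in> P" "e p \<in> fun_space.span (e ` P - {e p})"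
    \<comment> \<open>All the other functions vanish at p, and so does their span, but e p does not.\<close>
    have "fun_space.span (e ` P - {e p}) \<subseteq> {f. f p = 0}"
      using p(1) e(3) by (intro fun_space.span_minimal) (auto simp: fun_space.subspace_def fscale_def)
    then show False
      using p e(2) by auto
  qed
  then have "card (e ` P) \<le> card T"
    using fun_space.independent_span_bound[OF assms(3), of "e ` P"] UT e(1) by auto
  then show False
    using P(2) inj by (simp add: card_image)
qed

section \<open>Products of Hausdorff spaces\<close>

text \<open>
  In the proof of the Stone-Weierstrass theorem the compact space is mapped into a product with
  an arbitrary index type. The weaker separation axioms come first, because the arities of the
  three classes have to remain compatible with those that products with a countable index type
  inherit from their metric.
\<close>

lemma open_fun_coordinate:
  fixes U :: "'b::topological_space set"
  assumes "open U" shows "open {h :: 'a \<Rightarrow> 'b. h i \<in> U}"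
  using open_vimage[OF assms, of "\<lambda>h. h i"] by (simp add: vimage_def)

instance "fun" :: (type, t0_space) t0_space
proof
  fix f g :: "'a \<Rightarrow> 'b"
  assume "f \<noteq> g"
  then obtain i where i: "f i \<noteq> g i" by auto
  then obtain U where "open U" "(f i \<in> U) \<noteq> (g i \<in> U)"
    using t0_space_class.t0_space[OF i] by blast
  then show "\<exists>U. open U \<and> \<not> (f \<in> U \<longleftrightarrow> g \<in> U)"
    by (intro exI[of _ "{h. h i \<in> U}"]) (auto simp: open_fun_coordinate)
qed

instance "fun" :: (type, t1_space) t1_space
proof
  fix f g :: "'a \<Rightarrow> 'b"
  assume "f \<noteq> g"
  then obtain i where i: "f i \<noteq> g i" by auto
  then obtain U where "open U" "f i \<in> U" "g i \<notin> U"
    using t1_space_class.t1_space[OF i] by blast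
  then show "\<exists>U. open U \<and> f \<in> U \<and> g \<notin> U"
    by (intro exI[of _ "{h. h i \<in> U}"]) (auto simp: open_fun_coordinate)
qed

instance "fun" :: (type, t2_space) t2_space
proof
  fix f g :: "'a \<Rightarrow> 'b"
  assume "f \<noteq> g"
  then obtain i where i: "f i \<noteq> g i" by auto
  then obtain U V where "open U" "open V" "f i \<in> U" "g i \<in> V" "U \<inter> V = {}"
    using hausdorff[OF i] by blast
  then show "\<exists>U V. open U \<and> open V \<and> f \<in> U \<and> g \<in> V \<and> U \<inter> V = {}"
    by (intro exI[of _ "{h. h i \<in> U}"] exI[of _ "{h. h i \<in> V}"]) (auto simp: open_fun_coordinate)
qed

section \<open>Uniform approximation\<close>

definition fibre_constant :: "'a topology \<Rightarrow> ('a \<Rightarrow> 'k::real_normed_field) set \<Rightarrow> ('a \<Rightarrow> 'k) set"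
  where "fibre_constant X A = {f \<in> cont_funs X. \<forall>x y. (x, y) \<in> sim X A \<longrightarrow> f x = f y}"

lemma subspace_cont_funs: "fun_space.subspace (cont_funs X :: ('a \<Rightarrow> 'k::real_normed_field) set)"
proof -
  have "continuous_map X euclidean (\<lambda>x. c * f x)"
    if "continuous_map X euclidean f" for c and f :: "'a \<Rightarrow> 'k"
    using continuous_map_compose[OF that, of euclidean "(*) c"]
    by (simp add: o_def continuous_on_mult_left)
  then show ?thesis
    by (auto simp: fun_space.subspace_def cont_funs_def fscale_def plus_fun_def zero_fun_def
        intro!: continuous_map_add)
qed

lemma norm_le_sup_norm:
  assumes "compact_space X" "f \<in> cont_funs X" "x \<in> topspace X"
  shows "norm (f x) \<le> sup_norm X f"
proof -
  have "compactin euclidean (f ` topspace X)"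
    using assms by (intro image_compactin[of X]) (auto simp: compact_space_def cont_funs_def)
  then have "bounded (f ` topspace X)"
    by (simp add: compact_imp_bounded)
  then have "bdd_above ((\<lambda>x. norm (f x)) ` topspace X)"
    by (auto simp: bounded_iff bdd_above_def)
  then have "bdd_above (insert 0 ((\<lambda>x. norm (f x)) ` topspace X))"
    by simp
  then show ?thesis
    unfolding sup_norm_def using assms(3) by (intro cSup_upper) auto
qed

text \<open>
  On a compact space the supremum norm really dominates the values of the function, so that the
  norm closure can be described pointwise, without suprema.
\<close>

lemma norm_closure_iff_uniform_approx:
  assumes X: "compact_space X" and A: "A \<subseteq> cont_funs X"
  shows "f \<in> norm_closure X A \<longleftrightarrow>
    f \<in> cont_funs X \<and> (\<forall>e>0. \<exists>g\<in>A. \<forall>x\<in>topspace X. norm (f x - g x) < e)"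
proof (cases "f \<in> cont_funs X")
  case f: True
  have upper: "norm (f x - g x) < e" if "g \<in> A" "sup_norm X (f - g) < e" "x \<in> topspace X" for g e x
    using that norm_le_sup_norm[OF X fun_space.subspace_diff[OF subspace_cont_funs f], of g x] A
    by auto
  have lower: "sup_norm X (f - g) < e"
    if "0 < e" "\<And>x. x \<in> topspace X \<Longrightarrow> norm (f x - g x) < e / 2" for g e
  proof -
    have "sup_norm X (f - g) \<le> e / 2"
      unfolding sup_norm_def using that by (intro cSup_least) (auto intro: less_imp_le)
    with that(1) show ?thesis by simp
  qed
  show ?thesis
  proof safe
    fix e :: real assume fA: "f \<in> norm_closure X A" and "e > 0"
    then obtain g where "g \<in> A" "sup_norm X (f - g) < e"
      by (auto simp: norm_closure_def)
    then show "\<exists>g\<in>A. \<forall>x\<in>topspace X. norm (f x - g x) < e"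
      using upper by auto
  next
    assume approx: "\<forall>e>0. \<exists>g\<in>A. \<forall>x\<in>topspace X. norm (f x - g x) < e"
    have "\<exists>g\<in>A. sup_norm X (f - g) < e" if "e > 0" for e
    proof -
      have "e / 2 > 0" using that by simp
      with approx obtain g where "g \<in> A" "\<forall>x\<in>topspace X. norm (f x - g x) < e / 2"
        by blast
      with lower[OF that, of g] show ?thesis
        by auto
    qed
    with f show "f \<in> norm_closure X A"
      by (simp add: norm_closure_def)
  qed (rule f)
next
  case False
  then show ?thesis
    by (simp add: norm_closure_def)
qed

lemma norm_closure_subset_fibre_constant:
  assumes X: "compact_space X" and A: "A \<subseteq> cont_funs X"
  shows "norm_closure X A \<subseteq> fibre_constant X A"
proof
  fix f assume f: "f \<in> norm_closure X A"
  have "f x = f y" if xy: "(x, y) \<in> sim X A" for x y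
  proof -
    have "norm (f x - f y) \<le> e" if "e > 0" for e
    proof -
      obtain g where g: "g \<in> A" "\<forall>z\<in>topspace X. norm (f z - g z) < e / 2"
        using f half_gt_zero[OF \<open>e > 0\<close>]
        unfolding norm_closure_iff_uniform_approx[OF X A] by blast
      have "norm (f x - g x) < e / 2" "norm (f y - g y) < e / 2" "g x = g y"
        using xy g by (auto simp: sim_def)
      then show ?thesis
        using norm_triangle_ineq4[of "f x - g x" "f y - g y"] by simp
    qed
    then have "norm (f x - f y) \<le> 0"
      by (rule field_le_epsilon[where y = 0, simplified])
    then show ?thesis
      by simp
  qed
  then show "f \<in> fibre_constant X A"
    using f by (auto simp: fibre_constant_def norm_closure_def)
qed

lemma function_algebraD:
  assumes "function_algebra X A"
  shows function_algebra_subset: "A \<subseteq> cont_funs X"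
    and function_algebra_subspace: "fun_space.subspace A"
    and function_algebra_mult: "\<And>f g. f \<in> A \<Longrightarrow> g \<in> A \<Longrightarrow> (\<lambda>x. f x * g x) \<in> A"
    and function_algebra_add: "\<And>f g. f \<in> A \<Longrightarrow> g \<in> A \<Longrightarrow> (\<lambda>x. f x + g x) \<in> A"
    and function_algebra_scale: "\<And>f c. f \<in> A \<Longrightarrow> (\<lambda>x. c * f x) \<in> A"
    and function_algebra_zero: "(\<lambda>x. 0) \<in> A"
proof -
  show sub: "A \<subseteq> cont_funs X" "fun_space.subspace A"
    and "\<And>f g. f \<in> A \<Longrightarrow> g \<in> A \<Longrightarrow> (\<lambda>x. f x * g x) \<in> A"
    using assms by (simp_all add: function_algebra_def times_fun_def)
  show "\<And>f g. f \<in> A \<Longrightarrow> g \<in> A \<Longrightarrow> (\<lambda>x. f x + g x) \<in> A"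
    using fun_space.subspace_add[OF sub(2)] by (simp add: plus_fun_def)
  show "\<And>f c. f \<in> A \<Longrightarrow> (\<lambda>x. c * f x) \<in> A"
    using fun_space.subspace_scale[OF sub(2)] by (simp add: fscale_def)
  show "(\<lambda>x. 0) \<in> A"
    using fun_space.subspace_0[OF sub(2)] by (simp add: zero_fun_def)
qed

text \<open>
  Squares of members of \<open>A\<close> are nonnegative, and by compactness the sum of finitely many of them
  vanishes nowhere. Such a function serves as a substitute for the constants, which \<open>A\<close> may lack.
\<close>

lemma exists_positive_in_algebra:
  fixes A :: "('a \<Rightarrow> real) set"
  assumes X: "compact_space X" and A: "function_algebra X A" and nz: "vanishes_nowhere X A"
  obtains h where "h \<in> A" "\<And>x. x \<in> topspace X \<Longrightarrow> 0 < h x"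
proof -
  define U where "U = (\<lambda>f :: 'a \<Rightarrow> real. {x \<in> topspace X. f x \<in> - {0}})"
  have "openin X (U f)" if "f \<in> A" for f
    unfolding U_def using that function_algebra_subset[OF A]
    by (intro openin_continuous_map_preimage[of X euclidean]) (auto simp: cont_funs_def)
  moreover have "topspace X \<subseteq> \<Union>(U ` A)"
    using nz by (auto simp: U_def vanishes_nowhere_def)
  ultimately obtain \<F> where \<F>: "finite \<F>" "\<F> \<subseteq> U ` A" "topspace X \<subseteq> \<Union>\<F>"
    using X[unfolded compact_space_alt, rule_format, of "U ` A"] by auto
  obtain F where "finite F" "F \<subseteq> A" "\<F> = U ` F"
    using finite_subset_image[OF \<F>(1,2)] by auto
  with \<F>(3) have F: "finite F" "F \<subseteq> A" "topspace X \<subseteq> \<Union>(U ` F)"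
    by auto
  show thesis
  proof
    show "(\<lambda>x. \<Sum>f\<in>F. f x * f x) \<in> A"
      using F(1,2) by (induction F rule: finite_induct) 
        (simp_all add: function_algebra_zero[OF A] function_algebra_mult[OF A] function_algebra_add[OF A])
    show "0 < (\<Sum>f\<in>F. f x * f x)" if x: "x \<in> topspace X" for x
    proof -
      obtain f where "f \<in> F" "f x \<noteq> 0"
        using x F(3) by (auto simp: U_def)
      then show ?thesis
        using F(1) by (intro sum_pos2[of F f]) (auto simp: zero_less_mult_iff linorder_neq_iff)
    qed
  qed
qed

section \<open>The closure of a function algebra\<close>

lemma Hausdorff_space_euclidean_t2: "Hausdorff_space (euclidean :: 'a::t2_space topology)"
  unfolding Hausdorff_space_def
proof (intro allI impI)
  fix x y :: 'a
  assume "x \<in> topspace euclidean \<and> y \<in> topspace euclidean \<and> x \<noteq> y"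
  then obtain U V where "open U" "open V" "x \<in> U" "y \<in> V" "U \<inter> V = {}"
    using hausdorff[of x y] by auto
  then show "\<exists>U V. openin euclidean U \<and> openin euclidean V \<and> x \<in> U \<and> y \<in> V \<and> disjnt U V"
    unfolding disjnt_def by auto
qed

text \<open>
  The evaluation map \<open>\<Phi>\<close> sends a point to the family of its values under the members of \<open>A\<close>. Two
  points have the same image iff they are equivalent, so the image \<open>S\<close> is a compact Hausdorff
  model of the quotient of \<open>X\<close> by \<open>sim X A\<close>. A continuous function that is constant on the classes
  factors through \<open>\<Phi>\<close>. The coordinates separate the points of \<open>S\<close>, so that the classical theorem
  applies to the algebra \<open>R\<close> of those functions on \<open>S\<close> whose composition with \<open>\<Phi>\<close> is a member of \<open>A\<close>
  plus a constant.
\<close>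

lemma Stone_Weierstrass_affine:
  fixes A :: "('a \<Rightarrow> real) set"
  assumes X: "compact_space X" and A: "function_algebra X A"
    and f: "continuous_map X euclidean f" "\<And>x y. (x, y) \<in> sim X A \<Longrightarrow> f x = f y"
    and "e > 0"
  obtains g c where "g \<in> A" "\<And>x. x \<in> topspace X \<Longrightarrow> \<bar>f x - (g x + c)\<bar> < e"
proof -
  \<comment> \<open>The coordinates outside A are set to 0, so that they separate nothing.\<close>
  define \<Phi> where "\<Phi> = (\<lambda>x g. if g \<in> A then g x else 0)"
  define S where "S = \<Phi> ` topspace X"
  have eq_iff: "\<Phi> x = \<Phi> y \<longleftrightarrow> (x, y) \<in> sim X A" if "x \<in> topspace X" "y \<in> topspace X" for x y
    using that by (auto simp: \<Phi>_def sim_def fun_eq_iff)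
  have contA: "continuous_map X euclidean g" if "g \<in> A" for g
    using that function_algebra_subset[OF A] by (auto simp: cont_funs_def)
  have "continuous_map X (product_topology (\<lambda>_. euclidean) UNIV) \<Phi>"
    unfolding continuous_map_componentwise_UNIV
    by (auto simp: \<Phi>_def contA)
  then have cont\<Phi>: "continuous_map X euclidean \<Phi>"
    by (simp only: euclidean_product_topology)
  have "compactin euclidean S"
    unfolding S_def using X cont\<Phi> by (intro image_compactin[of X]) (auto simp: compact_space_def)
  then have S: "compact S"
    by simp
  have contS: "continuous_map X (top_of_set S) \<Phi>"
    using cont\<Phi> by (auto simp: continuous_map_in_subtopology S_def)
  \<comment> \<open>A continuous map from a compact space onto a Hausdorff space is a quotient map.\<close>
  have quotient: "quotient_map X (top_of_set S) \<Phi>"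
  proof (rule continuous_closed_imp_quotient_map[OF contS])
    show "closed_map X (top_of_set S) \<Phi>"
      by (intro continuous_imp_closed_map[OF contS X] Hausdorff_space_subtopology
          Hausdorff_space_euclidean_t2)
  qed (simp add: S_def)
  obtain F where F: "continuous_map (top_of_set S) euclidean F"
      "\<forall>x\<in>topspace X. F (\<Phi> x) = f x"
  proof (rule quotient_map_lift_exists[OF quotient f(1)])
    show "f x = f y" if "x \<in> topspace X" "y \<in> topspace X" "\<Phi> x = \<Phi> y" for x y
      using that eq_iff f(2) by auto
  qed (rule that, auto)
  define R where "R = {G. continuous_on S G \<and> (\<exists>g\<in>A. \<exists>c. \<forall>x\<in>topspace X. G (\<Phi> x) = g x + c)}"
  interpret function_ring_on R S
  proof
    show "compact S"
      by (rule S)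
    show "continuous_on S G" if "G \<in> R" for G
      using that by (simp add: R_def)
    show "(\<lambda>p. G p + H p) \<in> R" if GH: "G \<in> R" "H \<in> R" for G H
    proof -
      obtain g c h d where "g \<in> A" "h \<in> A"
        "\<forall>x\<in>topspace X. G (\<Phi> x) = g x + c" "\<forall>x\<in>topspace X. H (\<Phi> x) = h x + d"
        using GH unfolding R_def by blast
      then have "\<exists>k\<in>A. \<exists>b. \<forall>x\<in>topspace X. G (\<Phi> x) + H (\<Phi> x) = k x + b"
        by (intro bexI[of _ "\<lambda>x. g x + h x"] exI[of _ "c + d"])
          (simp_all add: function_algebra_add[OF A])
      with GH show ?thesis
        by (simp add: R_def continuous_on_add)
    qed
    show "(\<lambda>p. G p * H p) \<in> R" if GH: "G \<in> R" "H \<in> R" for G H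
    proof -
      obtain g c h d where gh: "g \<in> A" "h \<in> A"
        "\<forall>x\<in>topspace X. G (\<Phi> x) = g x + c" "\<forall>x\<in>topspace X. H (\<Phi> x) = h x + d"
        using GH unfolding R_def by blast
      have "(\<lambda>x. g x * h x + (d * g x + c * h x)) \<in> A"
        by (intro function_algebra_add[OF A] function_algebra_mult[OF A]
            function_algebra_scale[OF A] gh)
      then have "\<exists>k\<in>A. \<exists>b. \<forall>x\<in>topspace X. G (\<Phi> x) * H (\<Phi> x) = k x + b"
        using gh(3,4)
        by (intro bexI[of _ "\<lambda>x. g x * h x + (d * g x + c * h x)"] exI[of _ "c * d"])
          (simp_all add: algebra_simps)
      with GH show ?thesis
        by (simp add: R_def continuous_on_mult)
    qed
    show "(\<lambda>_. c) \<in> R" for c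
      using function_algebra_zero[OF A] by (auto simp: R_def intro!: bexI[of _ "\<lambda>x. 0"])
    show "\<exists>G\<in>R. G p \<noteq> G q" if "p \<in> S" "q \<in> S" "p \<noteq> q" for p q
    proof -
      obtain g where g: "p g \<noteq> q g"
        using \<open>p \<noteq> q\<close> by auto
      then have "g \<in> A"
        using that(1,2) by (auto simp: S_def \<Phi>_def split: if_splits)
      moreover have "continuous_on S (\<lambda>p. p g)"
        by (rule continuous_on_subset[OF continuous_on_product_coordinates]) simp
      ultimately have "(\<lambda>p. p g) \<in> R"
        by (auto simp: R_def \<Phi>_def intro!: bexI[of _ g] exI[of _ 0])
      with g show ?thesis
        by (intro bexI[of _ "\<lambda>p. p g"])
    qed
  qed
  have "continuous_on S F"
    using F(1) by simp
  from Stone_Weierstrass_basic[OF this \<open>e > 0\<close>]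
  obtain G where G: "G \<in> R" "\<forall>p\<in>S. \<bar>F p - G p\<bar> < e"
    by auto
  then obtain g c where "g \<in> A" "\<forall>x\<in>topspace X. G (\<Phi> x) = g x + c"
    by (auto simp: R_def)
  with G(2) F(2) show thesis
    by (intro that[of g c]) (auto simp: S_def)
qed

text \<open>
  To remove the constant \<open>c\<close> from the approximation by \<open>g + c\<close>, choose a positive \<open>h \<in> A\<close> and
  approximate \<open>f / h\<close> instead of \<open>f\<close>: if \<open>f / h\<close> is close to \<open>g + c\<close>, then \<open>f\<close> is close to
  \<open>h * g + c * h\<close>, which belongs to \<open>A\<close>.
\<close>

lemma norm_closure_real_algebra:
  fixes A :: "('a \<Rightarrow> real) set"
  assumes X: "compact_space X" and A: "function_algebra X A" and nz: "vanishes_nowhere X A"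
  shows "norm_closure X A = fibre_constant X A"
proof
  note AX = function_algebra_subset[OF A]
  show "norm_closure X A \<subseteq> fibre_constant X A"
    using X AX by (rule norm_closure_subset_fibre_constant)
  show "fibre_constant X A \<subseteq> norm_closure X A"
  proof
    fix f assume f: "f \<in> fibre_constant X A"
    obtain h where h: "h \<in> A" "\<And>x. x \<in> topspace X \<Longrightarrow> 0 < h x"
      using exists_positive_in_algebra[OF X A nz] by metis
    have hX: "h \<in> cont_funs X"
      using h(1) AX by auto
    \<comment> \<open>Multiplication by h enlarges errors by a factor of at most M; adding 1 makes M positive
      even if X is empty.\<close>
    define M where "M = sup_norm X h + 1"
    have M: "\<bar>h x\<bar> \<le> M" if "x \<in> topspace X" for x
      using norm_le_sup_norm[OF X hX that] by (simp add: M_def)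
    have "0 \<le> sup_norm X h \<or> topspace X = {}"
      using norm_le_sup_norm[OF X hX] norm_ge_zero order_trans by blast
    then have "M > 0"
      by (auto simp: M_def sup_norm_def)
    have cont: "continuous_map X euclidean (\<lambda>x. f x / h x)"
      using f hX h(2)
      by (intro continuous_map_real_divide) (force simp: fibre_constant_def cont_funs_def)+
    have const: "f x / h x = f y / h y" if "(x, y) \<in> sim X A" for x y
      using that f h(1) by (auto simp: fibre_constant_def sim_def)
    have "\<exists>g\<in>A. \<forall>x\<in>topspace X. norm (f x - g x) < e" if "e > 0" for e
    proof -
      have "e / M > 0"
        using \<open>e > 0\<close> \<open>M > 0\<close> by simp
      then obtain g c where g: "g \<in> A" "\<And>x. x \<in> topspace X \<Longrightarrow> \<bar>f x / h x - (g x + c)\<bar> < e / M"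
        using Stone_Weierstrass_affine[OF X A cont const] by blast
      have "(\<lambda>x. h x * g x + c * h x) \<in> A"
        by (intro function_algebra_add[OF A] function_algebra_mult[OF A]
            function_algebra_scale[OF A] g(1) h(1))
      moreover have "norm (f x - (h x * g x + c * h x)) < e" if x: "x \<in> topspace X" for x
      proof -
        have "f x - (h x * g x + c * h x) = h x * (f x / h x - (g x + c))"
          using h(2)[OF x] by (simp add: field_simps)
        then have "norm (f x - (h x * g x + c * h x)) = \<bar>h x\<bar> * \<bar>f x / h x - (g x + c)\<bar>"
          by (simp add: abs_mult)
        also have "\<dots> \<le> M * \<bar>f x / h x - (g x + c)\<bar>"
          using M[OF x] by (rule mult_right_mono) simp
        also have "\<dots> < M * (e / M)"
          using g(2)[OF x] \<open>M > 0\<close> by (rule mult_strict_left_mono)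
        finally show ?thesis
          using \<open>M > 0\<close> by simp
      qed
      ultimately show ?thesis
        by (intro bexI[of _ "\<lambda>x. h x * g x + c * h x"] ballI)
    qed
    with f show "f \<in> norm_closure X A"
      by (simp add: norm_closure_iff_uniform_approx[OF X AX] fibre_constant_def)
  qed
qed

text \<open>
  The real-valued members of a self-adjoint algebra form a real algebra \<open>B\<close> that contains the real
  and imaginary parts of all members. Hence \<open>B\<close> induces the same equivalence relation as \<open>A\<close> and
  vanishes nowhere, and the real and imaginary parts of a function can be approximated
  separately.
\<close>

lemma norm_closure_complex_algebra:
  fixes A :: "('a \<Rightarrow> complex) set"
  assumes X: "compact_space X" and A: "function_algebra X A"
    and adj: "self_adjoint cnj A" and nz: "vanishes_nowhere X A"
  shows "norm_closure X A = fibre_constant X A"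
proof
  note AX = function_algebra_subset[OF A]
  show "norm_closure X A \<subseteq> fibre_constant X A"
    using X AX by (rule norm_closure_subset_fibre_constant)
  define B where "B = {g. (\<lambda>x. complex_of_real (g x)) \<in> A}"
  have cnjA: "(\<lambda>x. cnj (f x)) \<in> A" if "f \<in> A" for f
    using that adj by (simp add: self_adjoint_def)
  have ReB: "(\<lambda>x. Re (f x)) \<in> B" if f: "f \<in> A" for f
  proof -
    have "(\<lambda>x. (1 / 2) * (f x + cnj (f x))) \<in> A"
      by (intro function_algebra_scale[OF A] function_algebra_add[OF A] cnjA f)
    also have "(\<lambda>x. (1 / 2) * (f x + cnj (f x))) = (\<lambda>x. complex_of_real (Re (f x)))"
      by (auto simp: complex_eq_iff)
    finally show ?thesis
      by (simp add: B_def)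
  qed
  have Re_cont: "continuous_map X euclidean (\<lambda>x. Re (f x))" 
    and Im_cont: "continuous_map X euclidean (\<lambda>x. Im (f x))"
    if "f \<in> cont_funs X" for f
    using continuous_map_compose[of X euclidean f euclidean Re]
      continuous_map_compose[of X euclidean f euclidean Im] that
    by (simp_all add: o_def cont_funs_def continuous_on_Re continuous_on_Im)
  have Re_funs: "(\<lambda>x. Re (f x)) \<in> cont_funs X" and Im_funs: "(\<lambda>x. Im (f x)) \<in> cont_funs X"
    if "f \<in> cont_funs X" for f
    using that Re_cont[OF that] Im_cont[OF that] by (simp_all add: cont_funs_def)
  have BX: "B \<subseteq> cont_funs X"
  proof
    fix g assume "g \<in> B"
    then have "(\<lambda>x. complex_of_real (g x)) \<in> cont_funs X"
      using AX by (auto simp: B_def)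
    from Re_funs[OF this] show "g \<in> cont_funs X"
      by simp
  qed
  have B: "function_algebra X B"
    unfolding function_algebra_def
  proof (intro conjI ballI BX fun_space.subspaceI)
    show "0 \<in> B"
      using function_algebra_zero[OF A] by (simp add: B_def)
    show "f + g \<in> B" if "f \<in> B" "g \<in> B" for f g
      using that function_algebra_add[OF A] by (simp add: B_def)
    show "fscale c f \<in> B" if "f \<in> B" for c f
      using that function_algebra_scale[OF A] by (simp add: B_def fscale_def)
    show "f * g \<in> B" if "f \<in> B" "g \<in> B" for f g
      using that function_algebra_mult[OF A] by (simp add: B_def)
  qed
  have nzB: "vanishes_nowhere X B"
    unfolding vanishes_nowhere_def
  proof
    fix x assume "x \<in> topspace X"
    then obtain f where f: "f \<in> A" "f x \<noteq> 0"
      using nz by (auto simp: vanishes_nowhere_def)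
    have "(\<lambda>y. Re (f y * cnj (f y))) \<in> B"
      by (intro ReB function_algebra_mult[OF A] cnjA f)
    moreover have "Re (f x * cnj (f x)) \<noteq> 0"
      using f(2) by (simp add: complex_mult_cnj complex_eq_iff sum_power2_eq_zero_iff)
    ultimately show "\<exists>g\<in>B. g x \<noteq> 0"
      by (intro bexI[of _ "\<lambda>y. Re (f y * cnj (f y))"])
  qed
  have simB: "(x, y) \<in> sim X A" if xy: "(x, y) \<in> sim X B" for x y
  proof -
    have "f x = f y" if f: "f \<in> A" for f
    proof -
      have "(\<lambda>z. Re (- \<i> * f z)) \<in> B"
        by (intro ReB function_algebra_scale[OF A] f)
      then have "Im (f x) = Im (f y)"
        using xy by (auto simp: sim_def)
      moreover have "Re (f x) = Re (f y)"
        using xy ReB[OF f] by (auto simp: sim_def)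
      ultimately show ?thesis
        by (rule complex_eqI[rotated])
    qed
    with xy show ?thesis
      by (simp add: sim_def)
  qed
  show "fibre_constant X A \<subseteq> norm_closure X A"
  proof
    fix f assume f: "f \<in> fibre_constant X A"
    then have fX: "f \<in> cont_funs X" and fsim: "\<And>x y. (x, y) \<in> sim X A \<Longrightarrow> f x = f y"
      by (auto simp: fibre_constant_def)
    have "(\<lambda>x. Re (f x)) \<in> fibre_constant X B" "(\<lambda>x. Im (f x)) \<in> fibre_constant X B"
      using Re_funs[OF fX] Im_funs[OF fX] fsim[OF simB] by (auto simp: fibre_constant_def)
    then have "(\<lambda>x. Re (f x)) \<in> norm_closure X B" "(\<lambda>x. Im (f x)) \<in> norm_closure X B"
      by (simp_all only: norm_closure_real_algebra[OF X B nzB])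
    then have approx: 
        "\<forall>e>0. \<exists>g\<in>B. \<forall>x\<in>topspace X. norm (Re (f x) - g x) < e"
        "\<forall>e>0. \<exists>g\<in>B. \<forall>x\<in>topspace X. norm (Im (f x) - g x) < e"
      by (simp_all add: norm_closure_iff_uniform_approx[OF X BX])
    have "\<exists>g\<in>A. \<forall>x\<in>topspace X. norm (f x - g x) < e" if "e > 0" for e
    proof -
      have e2: "e / 2 > 0"
        using that by simp
      obtain u v where u: "u \<in> B" "\<forall>x\<in>topspace X. norm (Re (f x) - u x) < e / 2"
        and v: "v \<in> B" "\<forall>x\<in>topspace X. norm (Im (f x) - v x) < e / 2"
        using approx[rule_format, OF e2] by auto
      have "(\<lambda>x. complex_of_real (u x) + \<i> * complex_of_real (v x)) \<in> A"
        using u(1) v(1)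
        by (intro function_algebra_add[OF A] function_algebra_scale[OF A]) (simp_all add: B_def)
      moreover have "norm (f x - (complex_of_real (u x) + \<i> * complex_of_real (v x))) < e"
        if x: "x \<in> topspace X" for x
      proof -
        have "norm (f x - (complex_of_real (u x) + \<i> * complex_of_real (v x)))
            \<le> \<bar>Re (f x) - u x\<bar> + \<bar>Im (f x) - v x\<bar>"
          using cmod_le[of "f x - (complex_of_real (u x) + \<i> * complex_of_real (v x))"] by simp
        also have "\<dots> < e / 2 + e / 2"
          using u(2) v(2) x by (intro add_strict_mono) auto
        finally show ?thesis
          by simp
      qed
      ultimately show ?thesis
        by (intro bexI[of _ "\<lambda>x. complex_of_real (u x) + \<i> * complex_of_real (v x)"] ballI)
    qed
    with fX show "f \<in> norm_closure X A"
      by (simp add: norm_closure_iff_uniform_approx[OF X AX])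
  qed
qed

section \<open>Nontrivial classes\<close>

lemma equiv_sim: "equiv (topspace X) (sim X A)"
proof (rule equivI)
  show "sim X A \<subseteq> topspace X \<times> topspace X"
    by (auto simp: sim_def)
  show "refl_on (topspace X) (sim X A)"
    by (rule refl_onI) (auto simp: sim_def)
  show "sym (sim X A)"
    by (rule symI) (auto simp: sim_def)
  show "trans (sim X A)"
    by (rule transI) (auto simp: sim_def)
qed

lemma closedin_sim_class:
  assumes "A \<subseteq> cont_funs X" "x \<in> topspace X"
  shows "closedin X (sim X A `` {x})"
proof -
  have "closedin X {y \<in> topspace X. f y \<in> {f x}}" if "f \<in> A" for f
    using that assms(1) by (intro closedin_continuous_map_preimage[of X euclidean]) (auto simp: cont_funs_def)
  then have "closedin X (\<Inter>(insert (topspace X) ((\<lambda>f. {y \<in> topspace X. f y \<in> {f x}}) ` A)))"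
    by (intro closedin_Inter) auto
  also have "\<Inter>(insert (topspace X) ((\<lambda>f. {y \<in> topspace X. f y \<in> {f x}}) ` A)) = sim X A `` {x}"
    using assms(2) by (fastforce simp: sim_def)
  finally show ?thesis .
qed

lemma nontrivial_points_eq_Union:
  "nontrivial_points X A = \<Union>{c \<in> topspace X // sim X A. nontrivial c}"
proof -
  have "x \<in> nontrivial_points X A" if "z \<in> topspace X" "x \<in> sim X A `` {z}" "nontrivial (sim X A `` {z})" for x z
  proof -
    have "sim X A `` {x} = sim X A `` {z}"
      using that(2) equiv_class_eq[OF equiv_sim, of z x X A] by auto
    with that show ?thesis
      by (auto simp: nontrivial_points_def sim_def)
  qed
  moreover have "x \<in> sim X A `` {x}" if "x \<in> topspace X" for x
    using that by (simp add: sim_def)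
  ultimately show ?thesis
    unfolding quotient_def by (auto simp: nontrivial_points_def)
qed

lemma closedin_nontrivial_points:
  assumes "A \<subseteq> cont_funs X" "finite {c \<in> topspace X // sim X A. nontrivial c}"
  shows "closedin X (nontrivial_points X A)"
  unfolding nontrivial_points_eq_Union
  using assms by (intro closedin_Union) (auto simp: quotient_def closedin_sim_class)

lemma sim_imp_eq_or_nontrivial:
  assumes "(x, y) \<in> sim X A"
  shows "x = y \<or> x \<in> nontrivial_points X A \<and> y \<in> nontrivial_points X A"
proof (cases "x = y")
  case False
  have "{x, y} \<subseteq> sim X A `` {x}" "{x, y} \<subseteq> sim X A `` {y}"
    using assms by (auto simp: sim_def)
  with False assms show ?thesis
    unfolding nontrivial_points_def nontrivial_def by (auto simp: sim_def)
qed simp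

text \<open>
  A point outside a transversal is equivalent to, and distinct from, the representative of its
  class.
\<close>

lemma infinite_nontrivial_points:
  assumes "infinite_equiv (topspace X) (sim X A)"
  shows "infinite (nontrivial_points X A)"
proof -
  obtain T where T: "transversal (topspace X) (sim X A) T" "infinite (topspace X - T)"
    using assms by (auto simp: infinite_equiv_def)
  have "x \<in> nontrivial_points X A" if x: "x \<in> topspace X" "x \<notin> T" for x
  proof -
    have "sim X A `` {x} \<in> topspace X // sim X A"
      using x(1) by (rule quotientI)
    then obtain t where "t \<in> sim X A `` {x}" "t \<in> T"
      using T(1) unfolding transversal_def by blast
    then show ?thesis
      using sim_imp_eq_or_nontrivial[of x t X A] x(2) by auto
  qed
  then have "topspace X - T \<subseteq> nontrivial_points X A"
    by auto
  with T(2) show ?thesis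
    using finite_subset by blast
qed

section \<open>Restriction to a closed set\<close>

text \<open>
  Extension by \<open>0\<close> outside \<open>N\<close> matches the representation of the functions on the subspace \<open>N\<close>.
\<close>

definition restrict_fun :: "'a set \<Rightarrow> ('a \<Rightarrow> 'k::zero) \<Rightarrow> 'a \<Rightarrow> 'k"
  where "restrict_fun N f = (\<lambda>x. if x \<in> N then f x else 0)"

lemma linear_restrict_fun: "Vector_Spaces.linear fscale fscale (restrict_fun N)"
  by unfold_locales (auto simp: restrict_fun_def fscale_def fun_eq_iff)

text \<open>
  Tietze's theorem for a scalar field \<open>'k\<close>, isolated as a property so that what follows is
  independent of the scalar field.
\<close>

definition tietze_space :: "'a topology \<Rightarrow> 'k::real_normed_field itself \<Rightarrow> bool"
  where "tietze_space X _ \<longleftrightarrow>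
    (\<forall>N g. closedin X N \<longrightarrow> g \<in> cont_funs (subtopology X N) \<longrightarrow>
      (\<exists>f \<in> (cont_funs X :: ('a \<Rightarrow> 'k) set). \<forall>x\<in>N. f x = g x))"

lemma tietze_extension_real:
  fixes g :: "'a \<Rightarrow> real"
  assumes "normal_space X" "closedin X N" "continuous_map (subtopology X N) euclidean g"
  obtains f where "f \<in> cont_funs X" "\<And>x. x \<in> N \<Longrightarrow> f x = g x"
proof -
  obtain h where h: "continuous_map X euclidean h" "\<And>x. x \<in> N \<Longrightarrow> h x = g x"
    using assms unfolding normal_space_iff_Tietze by meson
  have "continuous_map X euclidean (\<lambda>x. if x \<in> topspace X then h x else 0)"
    by (rule continuous_map_eq[OF h(1)]) simp
  then show thesis
    using h(2) closedin_subset[OF assms(2)]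
    by (intro that[of "\<lambda>x. if x \<in> topspace X then h x else 0"]) (auto simp: cont_funs_def)
qed

lemma tietze_space_real:
  assumes "normal_space X"
  shows "tietze_space X TYPE(real)"
  unfolding tietze_space_def
proof (intro allI impI)
  fix N and g :: "'a \<Rightarrow> real"
  assume N: "closedin X N" and "g \<in> cont_funs (subtopology X N)"
  then have "continuous_map (subtopology X N) euclidean g"
    by (simp add: cont_funs_def)
  then obtain f where "f \<in> cont_funs X" "\<And>x. x \<in> N \<Longrightarrow> f x = g x"
    using tietze_extension_real[OF assms N] by metis
  then show "\<exists>f\<in>cont_funs X. \<forall>x\<in>N. f x = g x"
    by auto
qed

lemma tietze_space_complex:
  assumes "normal_space X"
  shows "tietze_space X TYPE(complex)"
  unfolding tietze_space_def
proof (intro allI impI)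
  fix N and g :: "'a \<Rightarrow> complex"
  assume N: "closedin X N" and "g \<in> cont_funs (subtopology X N)"
  then have g: "continuous_map (subtopology X N) euclidean g"
    by (simp add: cont_funs_def)
  have "continuous_map (subtopology X N) euclidean (\<lambda>x. Re (g x))"
    "continuous_map (subtopology X N) euclidean (\<lambda>x. Im (g x))"
    using continuous_map_compose[OF g, of euclidean Re] continuous_map_compose[OF g, of euclidean Im]
    by (simp_all add: o_def continuous_on_Re continuous_on_Im)
  then obtain u v where u: "u \<in> cont_funs X" "\<And>x. x \<in> N \<Longrightarrow> u x = Re (g x)"
    and v: "v \<in> cont_funs X" "\<And>x. x \<in> N \<Longrightarrow> v x = Im (g x)"
    using tietze_extension_real[OF assms N] by metis
  have comp: "continuous_map X euclidean (\<lambda>x. c * complex_of_real (w x))"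
    if "w \<in> cont_funs X" for c w
    using that continuous_map_compose[of X euclidean w euclidean "\<lambda>t. c * complex_of_real t"]
    by (simp add: o_def cont_funs_def continuous_on_mult_left continuous_on_of_real)
  have "(\<lambda>x. 1 * complex_of_real (u x) + \<i> * complex_of_real (v x)) \<in> cont_funs X"
    using continuous_map_add[OF comp[OF u(1), of 1] comp[OF v(1), of \<i>]] u(1) v(1)
    by (simp add: cont_funs_def)
  then show "\<exists>f\<in>cont_funs X. \<forall>x\<in>N. f x = g x"
    using u(2) v(2) by (intro bexI) (auto simp: complex_eq_iff)
qed

text \<open>
  The inclusion from right to left is the extension property.
\<close>

lemma restrict_fun_cont_funs:
  assumes tietze: "tietze_space X TYPE('k::real_normed_field)" and N: "closedin X N"
  shows "restrict_fun N ` cont_funs X = (cont_funs (subtopology X N) :: ('a \<Rightarrow> 'k) set)"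
proof
  have top: "topspace (subtopology X N) = N"
    using closedin_subset[OF N] by auto
  show "restrict_fun N ` cont_funs X \<subseteq> (cont_funs (subtopology X N) :: ('a \<Rightarrow> 'k) set)"
  proof safe
    fix f :: "'a \<Rightarrow> 'k" assume "f \<in> cont_funs X"
    then have "continuous_map (subtopology X N) euclidean f"
      by (auto simp: cont_funs_def intro: continuous_map_from_subtopology)
    then have "continuous_map (subtopology X N) euclidean (restrict_fun N f)"
      by (rule continuous_map_eq) (simp add: restrict_fun_def)
    then show "restrict_fun N f \<in> cont_funs (subtopology X N)"
      unfolding cont_funs_def top by (simp add: restrict_fun_def)
  qed
  show "(cont_funs (subtopology X N) :: ('a \<Rightarrow> 'k) set) \<subseteq> restrict_fun N ` cont_funs X"
  proof
    fix g :: "'a \<Rightarrow> 'k" assume g: "g \<in> cont_funs (subtopology X N)"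
    then obtain f where f: "f \<in> cont_funs X" "\<forall>x\<in>N. f x = g x"
      using tietze N unfolding tietze_space_def by blast
    have "g x = restrict_fun N f x" for x
      using f(2) g by (auto simp: restrict_fun_def cont_funs_def top)
    then show "g \<in> restrict_fun N ` cont_funs X"
      using f(1) by blast
  qed
qed

text \<open>
  A finite set of points is closed and discrete in a Hausdorff space, so a unit vector on it is
  continuous and extends to the whole space.
\<close>

lemma cont_funs_not_finite_dim:
  assumes X: "Hausdorff_space X" and tietze: "tietze_space X TYPE('k::real_normed_field)"
    and N: "closedin X N" "infinite N" and "finite T"
  shows "\<not> restrict_fun N ` (cont_funs X :: ('a \<Rightarrow> 'k) set) \<subseteq> fun_space.span T"
proof (rule not_finite_dim_if_separating[OF N(2) _ \<open>finite T\<close>])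
  fix P p assume P: "finite P" "P \<subseteq> N" "p \<in> P"
  then have PX: "P \<subseteq> topspace X"
    using closedin_subset[OF N(1)] by auto
  then have top: "topspace (subtopology X P) = P"
    by auto
  have closedP: "closedin X P"
    by (rule closedin_Hausdorff_finite[OF X PX P(1)])
  have "t1_space (subtopology X P)"
    using X by (intro Hausdorff_imp_t1_space Hausdorff_space_subtopology)
  then have discrete: "subtopology X P = discrete_topology P"
    using P(1) top finite_t1_space_imp_discrete_topology by metis
  have "(\<lambda>x. if x = p then 1 else 0 :: 'k) \<in> cont_funs (subtopology X P)"
    unfolding discrete using P(3) by (auto simp: cont_funs_def)
  then obtain f :: "'a \<Rightarrow> 'k" where f: "f \<in> cont_funs X" "\<forall>x\<in>P. f x = (if x = p then 1 else 0)"
    using tietze closedP unfolding tietze_space_def by blast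
  then show "\<exists>e\<in>restrict_fun N ` (cont_funs X :: ('a \<Rightarrow> 'k) set). e p = 1 \<and> (\<forall>q\<in>P - {p}. e q = 0)"
    using P by (intro bexI[of _ "restrict_fun N f"]) (auto simp: restrict_fun_def)
qed

section \<open>Lineability\<close>

text \<open>
  A function that is constant on the classes is, on the union of the nontrivial classes, a linear
  combination of their finitely many indicator functions; the coefficients are its values.
\<close>

lemma restrict_fibre_constant_finite_dim:
  fixes A :: "('a \<Rightarrow> 'k::real_normed_field) set"
  assumes fin: "finite {c \<in> topspace X // sim X A. nontrivial c}"
  obtains T where "finite T"
    "restrict_fun (nontrivial_points X A) ` fibre_constant X A \<subseteq> fun_space.span T"
proof
  define C where "C = {c \<in> topspace X // sim X A. nontrivial c}"
  define N where "N = nontrivial_points X A"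
  define ind where "ind = (\<lambda>(c :: 'a set) x. if x \<in> c then 1 else 0 :: 'k)"
  show "finite (ind ` C)"
    using fin by (simp add: C_def)
  show "restrict_fun (nontrivial_points X A) ` fibre_constant X A \<subseteq> fun_space.span (ind ` C)"
  proof safe
    fix f assume f: "f \<in> fibre_constant X A"
    define k where "k = (\<lambda>c. f (SOME x. x \<in> c))"
    have k: "k c = f x" if "c \<in> C" "x \<in> c" for c x
    proof -
      have "(SOME x. x \<in> c) \<in> c"
        using that(2) by (rule someI)
      then have "((SOME x. x \<in> c), x) \<in> sim X A"
        using that quotient_eq_iff[OF equiv_sim, of c X A c] by (auto simp: C_def)
      with f show ?thesis
        by (auto simp: fibre_constant_def k_def)
    qed
    have sum_app: "(\<Sum>c\<in>S. fscale (k c) (ind c)) x = (\<Sum>c\<in>S. k c * ind c x)" if "finite S" for S x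
      using that by (induction S rule: finite_induct) (simp_all add: fscale_def)
    have "restrict_fun N f x = (\<Sum>c\<in>C. k c * ind c x)" for x
    proof (cases "x \<in> N")
      case True
      then obtain c where c: "c \<in> C" "x \<in> c"
        by (auto simp: N_def nontrivial_points_eq_Union C_def)
      have unique: "d = c" if "d \<in> C" "x \<in> d" for d
        using that c quotient_disj[OF equiv_sim, of d X A c] by (auto simp: C_def)
      have "k d * ind d x = (if d = c then f x else 0)" if "d \<in> C" for d
        using unique[OF that] c k[OF c] by (cases "x \<in> d") (auto simp: ind_def)
      then have "(\<Sum>c\<in>C. k c * ind c x) = (\<Sum>d\<in>C. if d = c then f x else 0)"
        by (rule sum.cong[OF refl])
      also have "\<dots> = f x"
        using fin c(1) by (simp add: C_def)
      finally show ?thesis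
        using True by (simp add: restrict_fun_def)
    next
      case False
      then have "ind c x = 0" if "c \<in> C" for c
        using that by (auto simp: ind_def N_def nontrivial_points_eq_Union C_def)
      with False show ?thesis
        by (simp add: restrict_fun_def)
    qed
    then have "restrict_fun N f = (\<Sum>c\<in>C. fscale (k c) (ind c))"
      using sum_app fin by (auto simp: fun_eq_iff C_def)
    also have "\<dots> \<in> fun_space.span (ind ` C)"
      by (intro fun_space.span_sum fun_space.span_scale fun_space.span_base) auto
    finally show "restrict_fun (nontrivial_points X A) f \<in> fun_space.span (ind ` C)"
      by (simp add: N_def)
  qed
qed

text \<open>
  Two distinct equivalent points both lie in nontrivial classes, so being constant on the classes
  is a condition on the restriction alone.
\<close>

lemma fibre_constant_if_restrict:
  assumes "f \<in> cont_funs X"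
    and "restrict_fun (nontrivial_points X A) f \<in> restrict_fun (nontrivial_points X A) ` fibre_constant X A"
  shows "f \<in> fibre_constant X A"
proof -
  obtain g where g: "g \<in> fibre_constant X A"
    "restrict_fun (nontrivial_points X A) f = restrict_fun (nontrivial_points X A) g"
    using assms(2) by auto
  have fg: "f x = g x" if "x \<in> nontrivial_points X A" for x
    using fun_cong[OF g(2), of x] that by (simp add: restrict_fun_def)
  have "f x = f y" if "(x, y) \<in> sim X A" for x y
    using sim_imp_eq_or_nontrivial[OF that] fg g(1) that by (auto simp: fibre_constant_def)
  with assms(1) show ?thesis
    by (auto simp: fibre_constant_def)
qed

lemma subspace_fibre_constant:
  fixes A :: "('a \<Rightarrow> 'k::real_normed_field) set"
  shows "fun_space.subspace (fibre_constant X A)"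
proof -
  have "fun_space.subspace {f :: 'a \<Rightarrow> 'k. \<forall>x y. (x, y) \<in> sim X A \<longrightarrow> f x = f y}"
    by (auto simp: fun_space.subspace_def fscale_def)
  from fun_space.subspace_inter[OF subspace_cont_funs this] show ?thesis
    by (simp add: fibre_constant_def Collect_conj_eq)
qed

text \<open>
  The argument after Stone-Weierstrass and Tietze, over an arbitrary scalar field: both
  theorems enter as hypotheses. The lower bound lifts a complement of the restrictions of the
  approximable functions, and the upper bound uses that restriction is injective on every
  subspace that meets the closure only in \<open>0\<close>.
\<close>

lemma lineability_of_nonapproximable_functions:
  fixes A :: "('a \<Rightarrow> 'k::real_normed_field) set"
  assumes X: "Hausdorff_space X" and tietze: "tietze_space X TYPE('k)"
    and A: "A \<subseteq> cont_funs X" and closure: "norm_closure X A = fibre_constant X A"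
    and inf: "infinite_equiv (topspace X) (sim X A)"
    and fin: "finite {c \<in> topspace X // sim X A. nontrivial c}"
  defines "\<kappa> \<equiv> (sw (subtopology X (nontrivial_points X A)) :: ('a \<Rightarrow> 'k) rel)"
  shows "lineable \<kappa> (cont_funs X - norm_closure X A) \<and>
    \<not> lineable (cardSuc \<kappa>) (cont_funs X - norm_closure X A)"
proof
  define N where "N = nontrivial_points X A"
  define r :: "('a \<Rightarrow> 'k) \<Rightarrow> 'a \<Rightarrow> 'k" where "r = restrict_fun N"
  define B where "B = fibre_constant X A"
  define V where "V = (cont_funs X :: ('a \<Rightarrow> 'k) set)"
  have N: "closedin X N" "infinite N"
    unfolding N_def using closedin_nontrivial_points[OF A fin] infinite_nontrivial_points[OF inf] by auto
  have lin: "Vector_Spaces.linear fscale fscale r"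
    unfolding r_def by (rule linear_restrict_fun)
  interpret r: Vector_Spaces.linear fscale fscale r by (rule lin)
  have V: "fun_space.subspace V" and B: "fun_space.subspace B"
    by (simp_all only: V_def B_def subspace_cont_funs subspace_fibre_constant)
  have BV: "B \<subseteq> V"
    by (auto simp: V_def B_def fibre_constant_def)
  have rV: "r ` V = cont_funs (subtopology X N)"
    unfolding r_def V_def by (rule restrict_fun_cont_funs[OF tietze N(1)])
  have \<kappa>: "\<kappa> = hamel_dim (r ` V)"
    by (simp add: \<kappa>_def sw_def rV N_def)
  have in_B: "f \<in> B" if "f \<in> V" "r f \<in> r ` B" for f
    using fibre_constant_if_restrict[of f X A] that by (simp add: V_def B_def r_def N_def)
  have M: "cont_funs X - norm_closure X A = V - B"
    by (simp add: closure V_def B_def)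
  obtain T where T: "finite T" "r ` B \<subseteq> fun_space.span T"
    unfolding r_def B_def N_def by (rule restrict_fibre_constant_finite_dim[OF fin])
  have inf_dim: "\<not> r ` V \<subseteq> fun_space.span T'" if "finite T'" for T'
    unfolding r_def V_def by (rule cont_funs_not_finite_dim[OF X tietze N that])
  obtain W where W: "fun_space.subspace W" "W \<subseteq> V" "\<forall>w\<in>W. r w \<in> r ` B \<longrightarrow> w = 0"
    "hamel_dim W =o hamel_dim (r ` V)"
  proof (rule large_subspace_avoiding_preimage[OF lin V r.subspace_image[OF B] image_mono[OF BV] T])
    show "\<not> r ` V \<subseteq> fun_space.span T'" if "finite T'" for T'
      using that by (rule inf_dim)
  qed (rule that)
  have "W \<subseteq> (V - B) \<union> {0}"
    using W(2,3) by auto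
  with W(1,4) show "lineable \<kappa> (cont_funs X - norm_closure X A)"
    unfolding lineable_def M \<kappa> by (intro exI[of _ W] conjI)
  show "\<not> lineable (cardSuc \<kappa>) (cont_funs X - norm_closure X A)"
  proof
    assume "lineable (cardSuc \<kappa>) (cont_funs X - norm_closure X A)"
    then obtain W where W: "fun_space.subspace W" "W \<subseteq> (V - B) \<union> {0}" "hamel_dim W =o cardSuc \<kappa>"
      unfolding lineable_def M by (elim exE conjE)
    have WV: "W \<subseteq> V"
      using W(2) fun_space.subspace_0[OF V] by auto
    \<comment> \<open>The kernel of r lies in B, since the zero function is the restriction of a member of B.\<close>
    have "w = 0" if "w \<in> W" "r w = 0" for w
    proof -
      have "r w \<in> r ` B"
        using that(2) fun_space.subspace_0[OF r.subspace_image[OF B]] by simp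
      then show ?thesis
        using in_B[of w] that(1) WV W(2) by auto
    qed
    then have inj: "inj_on r W"
      unfolding r.inj_on_iff_eq_0[OF W(1)] by (intro ballI impI)
    have "hamel_dim W =o hamel_dim (r ` W)"
      by (rule ordIso_symmetric[OF hamel_dim_inj_image[OF lin W(1) inj]])
    also have "hamel_dim (r ` W) \<le>o hamel_dim (r ` V)"
      by (intro hamel_dim_mono r.subspace_image W(1) V image_mono WV)
    also have "hamel_dim (r ` V) = \<kappa>"
      by (simp add: \<kappa>)
    finally have "hamel_dim W \<le>o \<kappa>" .
    with ordIso_symmetric[OF W(3)] have "cardSuc \<kappa> \<le>o \<kappa>"
      by (rule ordIso_ordLeq_trans)
    moreover have "\<kappa> <o cardSuc \<kappa>"
      unfolding \<kappa> by (rule cardSuc_greater[OF Card_order_hamel_dim])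
    ultimately show False
      using not_ordLess_ordLeq[of \<kappa> "cardSuc \<kappa>"] by (simp only:)
  qed
qed

theorem corollary3p14:
  fixes L :: "'a topology"
  assumes "compact_space L" and "Hausdorff_space L"
  shows
    "(\<forall>A :: ('a \<Rightarrow> real) set.
        function_algebra L A \<longrightarrow> self_adjoint id A \<longrightarrow> vanishes_nowhere L A \<longrightarrow>
        infinite_equiv (topspace L) (sim L A) \<longrightarrow>
        finite {c \<in> topspace L // sim L A. nontrivial c} \<longrightarrow>
        (let \<kappa> = (sw (subtopology L (nontrivial_points L A)) :: ('a \<Rightarrow> real) rel) in
          lineable \<kappa> (cont_funs L - norm_closure L A) \<and>
          \<not> lineable (cardSuc \<kappa>) (cont_funs L - norm_closure L A))) \<and>
     (\<forall>A :: ('a \<Rightarrow> complex) set.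
        function_algebra L A \<longrightarrow> self_adjoint cnj A \<longrightarrow> vanishes_nowhere L A \<longrightarrow>
        infinite_equiv (topspace L) (sim L A) \<longrightarrow>
        finite {c \<in> topspace L // sim L A. nontrivial c} \<longrightarrow>
        (let \<kappa> = (sw (subtopology L (nontrivial_points L A)) :: ('a \<Rightarrow> complex) rel) in
          lineable \<kappa> (cont_funs L - norm_closure L A) \<and>
          \<not> lineable (cardSuc \<kappa>) (cont_funs L - norm_closure L A)))"
proof -
  have normal: "normal_space L"
    using assms by (intro compact_Hausdorff_or_regular_imp_normal_space) auto
  show ?thesis
    unfolding Let_def
  proof (rule conjI; intro allI impI)
    fix A :: "('a \<Rightarrow> real) set"
    assume A: "function_algebra L A" "vanishes_nowhere L A"
      "infinite_equiv (topspace L) (sim L A)" "finite {c \<in> topspace L // sim L A. nontrivial c}"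
    show "lineable (sw (subtopology L (nontrivial_points L A)) :: ('a \<Rightarrow> real) rel)
          (cont_funs L - norm_closure L A) \<and>
        \<not> lineable (cardSuc (sw (subtopology L (nontrivial_points L A)) :: ('a \<Rightarrow> real) rel))
          (cont_funs L - norm_closure L A)"
      by (rule lineability_of_nonapproximable_functions[OF assms(2) tietze_space_real[OF normal]
            function_algebra_subset[OF A(1)] norm_closure_real_algebra[OF assms(1) A(1,2)] A(3,4)])
  next
    fix A :: "('a \<Rightarrow> complex) set"
    assume A: "function_algebra L A" "self_adjoint cnj A" "vanishes_nowhere L A"
      "infinite_equiv (topspace L) (sim L A)" "finite {c \<in> topspace L // sim L A. nontrivial c}"
    show "lineable (sw (subtopology L (nontrivial_points L A)) :: ('a \<Rightarrow> complex) rel)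
          (cont_funs L - norm_closure L A) \<and>
        \<not> lineable (cardSuc (sw (subtopology L (nontrivial_points L A)) :: ('a \<Rightarrow> complex) rel))
          (cont_funs L - norm_closure L A)"
      by (rule lineability_of_nonapproximable_functions[OF assms(2) tietze_space_complex[OF normal]
            function_algebra_subset[OF A(1)] norm_closure_complex_algebra[OF assms(1) A(1,2,3)] A(4,5)])
  qed
qed

end
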